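(* Let $n\ge 3$ be an integer. There exist integers $1\le p_1,p_2,p_3\le n$ with $$\prod_{i=1}^{3}\left(1+2\cos\left(\frac{p_i\pi}{n+1}\right)\right)=2$$ if and only if $6\mid (n+1)$ or $15\mid (n+1)$. Consequently, there exists a non-trivial $n\times n\times n$ board satisfying the neighbor-sum property if and only if $6\mid(n+1)$ or $15\mid (n+1)$.
   Context: An $n\times n\times n$ board is an assignment of an integer to each cell $(i_1,i_2,i_3)\in\{1,\ldots,n\}^3$. Two distinct cells are neighbors if their coordinates differ by at most $1$ in absolute value in each of the three positions. The board satisfies the neighbor-sum property if the number in each cell equals the sum of the numbers in all its neighboring cells. It is non-trivial if not all its entries are $0$. *)

theory Defs
  imports "HOL-Analysis.Analysis"
begin

type_synonym cell = "nat \<times> nat \<times> nat"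

definition cells :: "nat \<Rightarrow> cell set" where
  "cells n = {1..n} \<times> {1..n} \<times> {1..n}"

fun neighbors :: "cell \<Rightarrow> cell \<Rightarrow> bool" where
  "neighbors (i1, i2, i3) (j1, j2, j3) \<longleftrightarrow>
     (i1, i2, i3) \<noteq> (j1, j2, j3) \<and>
     \<bar>int i1 - int j1\<bar> \<le> 1 \<and> \<bar>int i2 - int j2\<bar> \<le> 1 \<and> \<bar>int i3 - int j3\<bar> \<le> 1"

(* A board of side n is represented by a function on all triples of naturals; the
   predicates below only inspect its values on cells n. *)

definition neighbor_sum_property :: "nat \<Rightarrow> (cell \<Rightarrow> int) \<Rightarrow> bool" where
  "neighbor_sum_property n B \<longleftrightarrow>
     (\<forall>c \<in> cells n. B c = (\<Sum>d \<in> {d \<in> cells n. neighbors c d}. B d))"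

definition nontrivial_board :: "nat \<Rightarrow> (cell \<Rightarrow> int) \<Rightarrow> bool" where
  "nontrivial_board n B \<longleftrightarrow> (\<exists>c \<in> cells n. B c \<noteq> 0)"

end

theory Submission
  imports Defs "HOL-Computational_Algebra.Polynomial"
begin

text \<open>
  The operator adding to each entry its neighbors is a tensor cube of the path matrix with unit
  diagonal, whose eigenvalues are \<open>1 + 2 cos (p pi / N) = 1 + u + 1/u\<close> with \<open>N = n + 1\<close> and
  \<open>u = exp (i pi p / N)\<close>. A board is an eigenvector for the eigenvalue 2; the discrete sine
  transform turns it into a product of three eigenvalues equal to 2.

  Such a product is analysed in \<open>\<int>[z]\<close> for a root of unity \<open>z\<close>, where no odd integer is divisible
  by 2. If 3 does not divide \<open>N\<close>, every factor is a unit, which is impossible. If \<open>N\<close> is odd,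
  a factor other than 2 divides an odd integer, so one factor is 2 and the other two satisfy
  \<open>(1 + X) (1 + Y) = 1\<close> with \<open>X = u + 1/u\<close> and \<open>Y = v + 1/v\<close>. The Galois automorphism squaring the
  roots of unity of odd order gives \<open>(1 \<plusminus> (X^2 - 2)) (1 \<plusminus> (Y^2 - 2)) = 1\<close>; eliminating \<open>Y\<close> leaves
  \<open>X^2 = X + 1\<close> as the only possibility, whence \<open>u^5 = -1\<close> and 5 divides \<open>N\<close>.
\<close>

section \<open>Integer polynomials evaluated at a root of unity\<close>

definition zeval :: "complex \<Rightarrow> int poly \<Rightarrow> complex" where
  "zeval z P = poly (map_poly of_int P) z"

lemma zeval_0 [simp]: "zeval z 0 = 0"
  by (simp add: zeval_def)

lemma zeval_pCons [simp]: "zeval z (pCons a P) = of_int a + z * zeval z P"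
  by (simp add: zeval_def map_poly_pCons)

lemma zeval_1 [simp]: "zeval z 1 = 1"
  by (simp add: zeval_def)

lemma zeval_numeral [simp]: "zeval z (numeral k) = numeral k"
  by (simp add: numeral_poly)

lemma zeval_add [simp]: "zeval z (P + Q) = zeval z P + zeval z Q"
  by (induction P Q rule: poly_induct2) (auto simp: algebra_simps)

lemma zeval_minus [simp]: "zeval z (- P) = - zeval z P"
  by (induction P) auto

lemma zeval_diff [simp]: "zeval z (P - Q) = zeval z P - zeval z Q"
  using zeval_add[of z P "- Q"] by simp

lemma zeval_smult [simp]: "zeval z (smult a P) = of_int a * zeval z P"
  by (induction P) (auto simp: algebra_simps)

lemma zeval_mult [simp]: "zeval z (P * Q) = zeval z P * zeval z Q"
  by (induction P) (auto simp: algebra_simps)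

lemma zeval_power [simp]: "zeval z (P ^ k) = zeval z P ^ k"
  by (induction k) auto

lemma zeval_monom [simp]: "zeval z (monom a k) = of_int a * z ^ k"
  by (induction k) (auto simp: monom_0 monom_Suc algebra_simps)

lemma zeval_pcompose_square [simp]: "zeval z (pcompose P [:0, 0, 1:]) = zeval (z ^ 2) P"
  by (induction P) (auto simp: pcompose_pCons power2_eq_square)

text \<open>Modulo 2, squaring is additive and fixes every constant, since \<open>a ^ 2 - a\<close>
  is even; so only the variable gets squared.\<close>

lemma frobenius_mod_2:
  fixes P :: "int poly"
  shows "\<exists>K. P ^ 2 = pcompose P [:0, 0, 1:] + 2 * K"
proof (induction P)
  case 0
  then show ?case by (intro exI[of _ 0]) simp
next
  case (pCons a P)
  then obtain K where K: "P ^ 2 = pcompose P [:0, 0, 1:] + 2 * K" by blast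
  have "even (a ^ 2 - a)" by simp
  then obtain b where b: "a ^ 2 = a + 2 * b" by (metis add.commute diff_add_cancel dvdE)
  have ring: "(A + X * P) ^ 2 = A + X ^ 2 * C + 2 * (B + A * X * P + X ^ 2 * D)"
    if "A ^ 2 = A + 2 * B" "P ^ 2 = C + 2 * D" for A B C D X :: "int poly"
    using that by algebra
  have "[:a:] ^ 2 = [:a:] + 2 * [:b:]"
    using b by (simp add: power2_eq_square numeral_poly)
  note ring[OF this K, of "[:0, 1:]"]
  also have "[:a:] + [:0, 1:] * P = pCons a P" by simp
  also have "[:a:] + [:0, 1:] ^ 2 * pcompose P [:0, 0, 1:] = pcompose (pCons a P) [:0, 0, 1:]"
    by (simp add: pcompose_pCons power2_eq_square)
  finally show ?case by blast
qed

section \<open>The ring Z[z]\<close>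

definition zadj :: "complex \<Rightarrow> complex set" where
  "zadj z = range (zeval z)"

lemma zadj_of_int [simp]: "of_int k \<in> zadj z"
  unfolding zadj_def by (rule range_eqI[of _ _ "[:k:]"]) simp

lemma zadj_1 [simp]: "1 \<in> zadj z" and zadj_0 [simp]: "0 \<in> zadj z"
  and zadj_of_nat [simp]: "of_nat k \<in> zadj z"
  using zadj_of_int[of 1 z] zadj_of_int[of 0 z] zadj_of_int[of "int k" z] by simp_all

lemma zadj_generator [simp]: "z \<in> zadj z"
  unfolding zadj_def by (rule range_eqI[of _ _ "[:0, 1:]"]) simp

lemma zadj_add: "a \<in> zadj z \<Longrightarrow> b \<in> zadj z \<Longrightarrow> a + b \<in> zadj z"
  unfolding zadj_def by (auto simp flip: zeval_add)

lemma zadj_diff: "a \<in> zadj z \<Longrightarrow> b \<in> zadj z \<Longrightarrow> a - b \<in> zadj z"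
  unfolding zadj_def by (auto simp flip: zeval_diff)

lemma zadj_minus: "a \<in> zadj z \<Longrightarrow> - a \<in> zadj z"
  unfolding zadj_def by (auto simp flip: zeval_minus)

lemma zadj_mult: "a \<in> zadj z \<Longrightarrow> b \<in> zadj z \<Longrightarrow> a * b \<in> zadj z"
  unfolding zadj_def by (auto simp flip: zeval_mult)

lemma zadj_power: "a \<in> zadj z \<Longrightarrow> a ^ k \<in> zadj z"
  unfolding zadj_def by (auto simp flip: zeval_power)

lemma zadj_sum: "(\<And>i. i \<in> I \<Longrightarrow> f i \<in> zadj z) \<Longrightarrow> sum f I \<in> zadj z"
  by (induction I rule: infinite_finite_induct) (auto intro: zadj_add)

lemmas zadj_intros = zadj_add zadj_diff zadj_minus zadj_mult zadj_power zadj_sum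

text \<open>Gauss's lemma: contents multiply and \<open>m\<close> has content 1, so \<open>c\<close>
  divides the content of the cofactor and cancels.\<close>

lemma primitive_dvd_smultD:
  fixes m F :: "int poly"
  assumes "content m = 1" "c \<noteq> 0" "m dvd smult c F"
  shows "m dvd F"
proof -
  obtain q where q: "smult c F = m * q" using assms(3) by (elim dvdE)
  have "content (smult c F) = content q" unfolding q using assms(1) by (simp add: content_mult)
  then have "c dvd content q" by (metis content_smult dvd_mult2 dvd_normalize_iff dvd_refl normalize_mult dvd_triv_left)
  then have "[:c:] dvd q" by (simp add: const_poly_dvd_iff_dvd_content)
  then obtain q' where "q = [:c:] * q'" by (elim dvdE)
  then have "smult c F = smult c (m * q')" using q by simp
  then have "F = m * q'" using assms(2) by (metis smult_cancel)
  then show ?thesis by simp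
qed

text \<open>Among the nonzero polynomials vanishing at \<open>z\<close>, take the primitive part of
  one of least degree. Pseudo-division by it leaves remainder 0 by minimality, and Gauss's lemma
  removes the scalar. It divides \<open>x ^ M - 1\<close>, so its leading coefficient is 1 or
  -1.\<close>

lemma minimal_int_poly:
  assumes "z ^ M = 1" "M > 0"
  obtains m where "lead_coeff m = 1" "zeval z m = 0" "degree m > 0"
    "\<And>F. zeval z F = 0 \<Longrightarrow> m dvd F"
proof -
  define XM where "XM = (monom 1 M - 1 :: int poly)"
  have XM0: "zeval z XM = 0" using assms(1) by (simp add: XM_def)
  have XMdeg: "degree XM = M" "lead_coeff XM = 1"
  proof -
    have "XM = monom 1 M + (- 1)" by (simp add: XM_def)
    then show "degree XM = M"
      using assms(2) degree_add_eq_left[of "- 1" "monom 1 M :: int poly"] by (simp add: degree_monom_eq)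
    then show "lead_coeff XM = 1" using assms(2) by (simp add: XM_def)
  qed
  define vanish where "vanish P \<longleftrightarrow> P \<noteq> 0 \<and> zeval z P = 0" for P
  have "vanish XM" using XM0 XMdeg by (auto simp: vanish_def)
  then obtain m0 where m0: "vanish m0" and min: "\<And>P. vanish P \<Longrightarrow> degree m0 \<le> degree P"
    using arg_min_natI[of vanish XM degree] arg_min_nat_le[of vanish _ degree] by metis
  define m1 where "m1 = primitive_part m0"
  have c1: "content m1 = 1" using m0 by (simp add: m1_def vanish_def)
  have "zeval z (smult (content m0) m1) = 0"
    unfolding m1_def content_times_primitive_part using m0 by (simp add: vanish_def)
  then have z1: "zeval z m1 = 0" using m0 by (simp add: vanish_def)
  have m1n: "m1 \<noteq> 0" using c1 by auto
  have d1: "degree m1 = degree m0" by (simp add: m1_def)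
  have dvd1: "m1 dvd F" if F: "zeval z F = 0" for F
  proof -
    obtain c q where cq: "c \<noteq> 0" "smult c F = m1 * q + pseudo_mod F m1"
      using pseudo_mod(1)[OF m1n, of F] by blast
    have "zeval z (smult c F) = zeval z (m1 * q + pseudo_mod F m1)" using cq by simp
    then have "zeval z (pseudo_mod F m1) = 0" using F z1 by simp
    then have "pseudo_mod F m1 = 0"
      using pseudo_mod(2)[OF m1n, of F] min[of "pseudo_mod F m1"] d1 by (fastforce simp: vanish_def)
    then show ?thesis using cq c1 primitive_dvd_smultD[of m1 c F] by simp
  qed
  have "m1 dvd XM" using dvd1 XM0 by blast
  then have "lead_coeff m1 dvd 1" using XMdeg(2) by (metis dvdE dvd_triv_left lead_coeff_mult)
  then have l: "lead_coeff m1 = 1 \<or> lead_coeff m1 = - 1" by auto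
  define m where "m = smult (lead_coeff m1) m1"
  have mlead: "lead_coeff m = 1" using l by (auto simp: m_def)
  have mz: "zeval z m = 0" using z1 by (simp add: m_def)
  have "degree m > 0"
  proof (rule ccontr)
    assume "\<not> degree m > 0"
    then have "m = 1" using mlead by (metis degree_eq_zeroE lead_coeff_pCons(2) gr0I one_pCons coeff_pCons_0 degree_0)
    then show False using mz by simp
  qed
  moreover have "m dvd F" if "zeval z F = 0" for F
    using dvd1[OF that] l by (auto simp: m_def)
  ultimately show ?thesis using that mlead mz by blast
qed

text \<open>Reducing a polynomial for \<open>a\<close> modulo the monic minimal polynomial gives
  \<open>r\<close>; then \<open>k - 2 * r\<close> vanishes at \<open>z\<close> in too low a degree,
  so it is 0, although its constant coefficient is odd.\<close>

lemma odd_ne_double_zadj: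
  assumes "z ^ M = 1" "M > 0" "odd k" "a \<in> zadj z" "of_int k = 2 * a"
  shows False
proof -
  obtain m where m: "lead_coeff m = 1" "zeval z m = 0" "degree m > 0"
    "\<And>F. zeval z F = 0 \<Longrightarrow> m dvd F"
    using minimal_int_poly assms(1,2) by metis
  obtain P where P: "a = zeval z P" using assms(4) by (auto simp: zadj_def)
  have "m \<noteq> 0" using m by auto
  \<comment> \<open>For a monic divisor, pseudo-division is ordinary division: the scaling power of
    the leading coefficient is 1.\<close>
  obtain q where q: "P = m * q + pseudo_mod P m"
    using m(1) pseudo_divmod[OF \<open>m \<noteq> 0\<close>, of P "fst (pseudo_divmod P m)" "snd (pseudo_divmod P m)"]
    by (auto simp: pseudo_mod_def)
  define r where "r = pseudo_mod P m"
  have r: "r = 0 \<or> degree r < degree m"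
    using pseudo_mod(2)[OF \<open>m \<noteq> 0\<close>, of P] by (simp add: r_def)
  define T where "T = [:k:] - smult 2 r"
  have "zeval z P = zeval z r" using arg_cong[OF q, of "zeval z"] m(2) by (simp add: r_def)
  then have "zeval z T = 0" using P assms(5) by (simp add: T_def)
  then have "m dvd T" by (rule m(4))
  moreover have "degree T < degree m"
    unfolding T_def using r m(3) by (intro degree_diff_less) auto
  ultimately have "T = 0" by (metis dvd_imp_degree_le leD)
  then have "coeff T 0 = 0" by simp
  then show False using assms(3) by (simp add: T_def)
qed

text \<open>This is the action of the Galois automorphism that squares the roots of unity of odd order.\<close>

lemma zeval_square_root_of_unity:
  assumes "z ^ N = 1" "odd N" "zeval z F = 0"
  shows "zeval (z ^ 2) F = 0"
proof -
  have N: "N > 0" using assms(2) by (rule odd_pos)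
  obtain m where m: "lead_coeff m = 1" "zeval z m = 0" "degree m > 0"
    "\<And>F. zeval z F = 0 \<Longrightarrow> m dvd F"
    using minimal_int_poly assms(1) N by metis
  have "m dvd monom 1 N - 1" using assms(1) by (intro m(4)) simp
  then obtain g where g: "monom 1 N - 1 = m * g" by (elim dvdE)
  have "(z ^ 2) ^ N = 1" using assms(1) by (metis power_mult mult.commute power_one)
  then have "zeval (z ^ 2) m * zeval (z ^ 2) g = 0"
    using arg_cong[OF g, of "zeval (z ^ 2)"] by simp
  \<comment> \<open>If \<open>g\<close> vanished at \<open>z ^ 2\<close>,
    \<open>frobenius_mod_2\<close> would put \<open>g(z) ^ 2\<close> in 2 Z[z]. Differentiating
    \<open>x ^ N - 1 = m * g\<close> at \<open>z\<close> shows that \<open>g(z)\<close> divides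
    \<open>N\<close>, so the odd number \<open>N ^ 2\<close> would be in 2 Z[z] too.\<close>
  moreover have "zeval (z ^ 2) g \<noteq> 0"
  proof
    assume g0: "zeval (z ^ 2) g = 0"
    obtain K where "g ^ 2 = pcompose g [:0, 0, 1:] + 2 * K"
      using frobenius_mod_2 by blast
    from arg_cong[OF this, of "zeval z"] g0 have g2: "zeval z g ^ 2 = 2 * zeval z K" by simp
    have "monom (int N) (N - 1) = pderiv m * g + m * pderiv g"
      using arg_cong[OF g, of pderiv] by (simp add: pderiv_diff pderiv_monom pderiv_mult algebra_simps)
    from arg_cong[OF this, of "zeval z"] m(2)
    have "of_nat N * z ^ (N - 1) = zeval z (pderiv m) * zeval z g" by simp
    moreover have "z ^ (N - 1) * z = 1" using assms(1) N by (metis power_minus_mult)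
    ultimately have "of_nat N = zeval z (pderiv m) * zeval z g * z"
      by (metis mult.assoc mult.right_neutral)
    then have "of_nat N ^ 2 = zeval z (pderiv m) ^ 2 * zeval z g ^ 2 * z ^ 2"
      by (simp add: power_mult_distrib)
    also have "\<dots> = 2 * (zeval z (pderiv m) ^ 2 * zeval z K * z ^ 2)"
      by (simp add: g2)
    finally have "of_int (int N ^ 2) = 2 * (zeval z (pderiv m) ^ 2 * zeval z K * z ^ 2)" by simp
    moreover have "zeval z (pderiv m) ^ 2 * zeval z K * z ^ 2 \<in> zadj z"
      by (intro zadj_intros zadj_generator) (auto simp: zadj_def)
    ultimately show False using odd_ne_double_zadj[OF assms(1) N, of "int N ^ 2"] assms(2) by (metis even_of_nat even_power)
  qed
  ultimately have "zeval (z ^ 2) m = 0" by simp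
  moreover obtain q where "F = m * q" using m(4)[OF assms(3)] by (elim dvdE)
  ultimately show ?thesis by simp
qed

section \<open>Divisibility of \<open>1 + u + 1/u\<close>\<close>

definition tri :: "complex \<Rightarrow> complex" where
  "tri u = 1 + u + inverse u"

lemma tri_times_self: "u \<noteq> 0 \<Longrightarrow> tri u * u = 1 + u + u ^ 2"
  by (simp add: tri_def field_simps power2_eq_square)

lemma root_of_unity_nonzero: "(u :: complex) ^ M = 1 \<Longrightarrow> M > 0 \<Longrightarrow> u \<noteq> 0"
  by (auto simp: power_0_left)

text \<open>As 3 is invertible modulo \<open>M\<close>, \<open>u\<close> is a power of
  \<open>u ^ 3\<close>. Hence \<open>1 - u ^ 3\<close> divides \<open>1 - u\<close>, while
  \<open>1 - u ^ 3 = (1 - u) * (1 + u + u ^ 2)\<close>; cancelling \<open>1 - u\<close> leaves a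
  unit.\<close>

lemma tri_unit_of_not_3_dvd:
  assumes "u ^ M = 1" "M > 0" "\<not> 3 dvd M" "u \<noteq> 1" "u \<in> zadj z"
  shows "\<exists>y\<in>zadj z. tri u * y = 1"
proof -
  have u0: "u \<noteq> 0" using assms(1,2) by (rule root_of_unity_nonzero)
  have "3 dvd 1 + M \<or> 3 dvd 1 + 2 * M" using assms(3) by presburger
  then obtain k c where k: "3 * k = 1 + c * M" by (metis dvdE mult_1)
  have "u ^ (3 * k) = u" unfolding k by (simp add: power_add power_mult mult.commute assms(1))
  then have "(1 - u ^ 3) * (\<Sum>j<k. (u ^ 3) ^ j) = 1 - u"
    by (simp add: power_mult flip: one_diff_power_eq)
  moreover have "1 - u ^ 3 = (1 - u) * (tri u * u)"
    using tri_times_self[OF u0] by algebra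
  ultimately have "(1 - u) * (tri u * (u * (\<Sum>j<k. (u ^ 3) ^ j))) = (1 - u) * 1" by algebra
  then have "tri u * (u * (\<Sum>j<k. (u ^ 3) ^ j)) = 1" using assms(4) by simp
  then show ?thesis using assms(5)
    by (intro bexI[of _ "u * (\<Sum>j<k. (u ^ 3) ^ j)"]) (auto intro!: zadj_intros)
qed

text \<open>For odd \<open>N\<close>, \<open>r\<close> is the power \<open>(N + 1) div 2\<close> of
  \<open>r ^ 2\<close>, so \<open>1 - r ^ 2\<close> divides \<open>1 - r\<close>; cancelling
  \<open>1 - r\<close> gives the explicit inverse.\<close>

lemma one_plus_unit:
  assumes "r ^ N = 1" "odd N" "r \<noteq> (1 :: complex)"
  shows "(1 + r) * (\<Sum>j<(N + 1) div 2. (r ^ 2) ^ j) = 1"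
proof -
  have "(1 - r ^ 2) * (\<Sum>j<(N + 1) div 2. (r ^ 2) ^ j) = 1 - (r ^ 2) ^ ((N + 1) div 2)"
    by (simp add: one_diff_power_eq)
  also have "(r ^ 2) ^ ((N + 1) div 2) = r ^ (N + 1)"
    using assms(2) by (subst power_mult[symmetric]) simp
  also have "\<dots> = r" using assms(1) by simp
  finally have "(1 - r) * ((1 + r) * (\<Sum>j<(N + 1) div 2. (r ^ 2) ^ j)) = (1 - r) * 1"
    by algebra
  then show ?thesis using assms(3) by simp
qed

text \<open>Summation by parts, together with the vanishing of the full geometric sum.\<close>

lemma root_of_unity_minus_one_dvd:
  assumes "r ^ N = 1" "r \<noteq> (1 :: complex)"
  shows "(r - 1) * (\<Sum>j<N. of_nat j * r ^ j) = of_nat N"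
proof -
  have "(r - 1) * (\<Sum>j<n. of_nat j * r ^ j) = of_nat n * r ^ n - r * (\<Sum>j<n. r ^ j)" for n
    by (induction n) (auto simp: algebra_simps)
  moreover have "(\<Sum>j<N. r ^ j) = 0"
    using one_diff_power_eq[of r N] assms by simp
  ultimately show ?thesis using assms(1) by simp
qed

text \<open>Up to the unit \<open>u\<close>, \<open>tri u\<close> divides \<open>u ^ 3 - 1\<close>.
  If \<open>u ^ N = 1\<close>, this divides the odd number \<open>N\<close>. If
  \<open>u ^ N = - 1\<close>, then \<open>- (u ^ 3)\<close> has odd order and
  \<open>1 - u ^ 3\<close> is a unit, except when \<open>u ^ 3 = - 1\<close>, which gives
  \<open>tri u = 2\<close>.\<close>

lemma tri_dvd_odd:
  assumes "u ^ (2 * N) = 1" "odd N" "u \<in> zadj z" "u \<noteq> 1" "u \<noteq> - 1" "tri u \<noteq> 0"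
  shows "tri u = 2 \<or> (\<exists>y\<in>zadj z. \<exists>k. odd k \<and> tri u * y = of_int k)"
proof -
  have "N > 0" using assms(2) by (rule odd_pos)
  then have u0: "u \<noteq> 0" using assms(1) \<open>N > 0\<close> by (intro root_of_unity_nonzero[of u "2 * N"]) auto
  have tu: "tri u * u = 1 + u + u ^ 2" by (rule tri_times_self[OF u0])
  have "(u ^ N) ^ 2 = 1" using assms(1) by (simp add: power_mult mult.commute flip: power_mult)
  then consider "u ^ N = 1" | "u ^ N = - 1" by (auto simp: power2_eq_1_iff)
  then show ?thesis
  proof cases
    case 1
    have "u ^ 3 \<noteq> 1"
    proof
      assume "u ^ 3 = 1"
      then have "(u - 1) * u * tri u = 0" using tu by algebra
      then show False using assms(4,6) u0 by simp
    qed
    moreover have "(u ^ 3) ^ N = 1" using 1 by (metis power_commutes power_mult mult.commute power_one)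
    ultimately have "(u ^ 3 - 1) * (\<Sum>j<N. of_nat j * (u ^ 3) ^ j) = of_nat N"
      by (intro root_of_unity_minus_one_dvd)
    moreover have "u ^ 3 - 1 = (tri u * u) * (u - 1)" unfolding tu by algebra
    ultimately have "tri u * (u * (u - 1) * (\<Sum>j<N. of_nat j * (u ^ 3) ^ j)) = of_int (int N)"
      by (simp add: mult_ac)
    moreover have "u * (u - 1) * (\<Sum>j<N. of_nat j * (u ^ 3) ^ j) \<in> zadj z"
      using assms(3) by (intro zadj_intros) auto
    ultimately show ?thesis using assms(2) by (metis even_of_nat)
  next
    case 2
    show ?thesis
    proof (cases "u ^ 3 = - 1")
      case True
      then have "(u + 1) * (tri u * u - 2 * u) = 0" using tu by algebra
      moreover have "u + 1 \<noteq> 0" using assms(5) by (simp add: eq_neg_iff_add_eq_0)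
      ultimately show ?thesis using u0 by simp
    next
      case False
      have "(- (u ^ 3)) ^ N = - ((u ^ N) ^ 3)"
        using assms(2) by (simp add: power_mult mult.commute flip: power_mult)
      then have "(- (u ^ 3)) ^ N = 1" using 2 by simp
      from one_plus_unit[OF this assms(2)] False
      have "(1 + - (u ^ 3)) * (\<Sum>j<(N + 1) div 2. ((- (u ^ 3)) ^ 2) ^ j) = 1"
        by (metis minus_minus)
      then have "tri u * (u * (1 - u) * (\<Sum>j<(N + 1) div 2. ((- (u ^ 3)) ^ 2) ^ j)) = of_int 1"
        using tu unfolding of_int_1 by algebra
      moreover have "u * (1 - u) * (\<Sum>j<(N + 1) div 2. ((- (u ^ 3)) ^ 2) ^ j) \<in> zadj z"
        using assms(3) by (intro zadj_intros) auto
      ultimately show ?thesis by (metis odd_one)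
    qed
  qed
qed

text \<open>Otherwise each factor divides an odd integer, and the product of these integers would be
  odd and twice an element of Z[z].\<close>

lemma tri_prod_2_odd:
  assumes z: "z ^ M = 1" "M > 0" and "odd N"
    and uvw: "\<And>x. x \<in> {u, v, w} \<Longrightarrow> x ^ (2 * N) = 1 \<and> x \<in> zadj z \<and> x \<noteq> 1 \<and> x \<noteq> - 1"
    and prod: "tri u * tri v * tri w = 2"
  shows "tri u = 2 \<or> tri v = 2 \<or> tri w = 2"
proof (rule ccontr)
  assume neg: "\<not> ?thesis"
  have "\<exists>y\<in>zadj z. \<exists>k. odd k \<and> tri x * y = of_int k" if "x \<in> {u, v, w}" for x
  proof -
    have "tri x \<noteq> 0" "tri x \<noteq> 2" using prod neg that by auto
    then show ?thesis using tri_dvd_odd[of x N z] uvw[OF that] \<open>odd N\<close> by blast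
  qed
  then obtain a b c k l m where y: "a \<in> zadj z" "b \<in> zadj z" "c \<in> zadj z"
    "odd k" "odd l" "odd m" "tri u * a = of_int k" "tri v * b = of_int l" "tri w * c = of_int m"
    by (metis insertI1 insertI2)
  have "of_int (k * l * m) = 2 * (a * b * c)"
  proof -
    have "of_int (k * l * m) = (tri u * tri v * tri w) * (a * b * c)"
      unfolding of_int_mult y(7-9)[symmetric] by (simp add: mult_ac)
    then show ?thesis unfolding prod .
  qed
  then show False using odd_ne_double_zadj[OF z, of "k * l * m" "a * b * c"] y
    by (auto intro!: zadj_intros)
qed

lemma tri_prod_ne_2_of_not_3_dvd:
  assumes z: "z ^ M = 1" "M > 0" and "\<not> 3 dvd M"
    and uvw: "\<And>x. x \<in> {u, v, w} \<Longrightarrow> x ^ M = 1 \<and> x \<in> zadj z \<and> x \<noteq> 1"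
  shows "tri u * tri v * tri w \<noteq> 2"
proof
  assume prod: "tri u * tri v * tri w = 2"
  have "\<exists>y\<in>zadj z. tri x * y = 1" if "x \<in> {u, v, w}" for x
    using tri_unit_of_not_3_dvd[of x M z] uvw[OF that] assms by blast
  then obtain a b c where y: "a \<in> zadj z" "b \<in> zadj z" "c \<in> zadj z"
    "tri u * a = 1" "tri v * b = 1" "tri w * c = 1"
    by (metis insertI1 insertI2)
  have "of_int 1 = 2 * (a * b * c)"
  proof -
    have "of_int 1 = (tri u * a) * (tri v * b) * (tri w * c)" by (simp add: y(4-6))
    also have "\<dots> = (tri u * tri v * tri w) * (a * b * c)" by (simp add: mult_ac)
    finally show ?thesis unfolding prod .
  qed
  then show False using odd_ne_double_zadj[OF z, of 1 "a * b * c"] y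
    by (auto intro!: zadj_intros)
qed

section \<open>Two factors with product 1\<close>

text \<open>The relation is a polynomial identity in \<open>z\<close>, so it survives
  \<open>z\<close> becoming \<open>z ^ 2\<close>. The signs stay fixed while the powers of
  \<open>z\<close> are squared; this turns \<open>X = u + inverse u\<close> into
  \<open>e * (X ^ 2 - 2)\<close>.\<close>

lemma tri_prod_1_conjugate:
  assumes z: "z ^ N = 1" "odd N" and e: "(e :: int) = 1 \<or> e = - 1" "(d :: int) = 1 \<or> d = - 1"
    and u: "u = of_int e * z ^ i" and v: "v = of_int d * z ^ j"
    and uv: "tri u * tri v = 1"
  shows "(1 + of_int e * ((u + inverse u) ^ 2 - 2)) * (1 + of_int d * ((v + inverse v) ^ 2 - 2)) = 1"
proof -
  have N: "N > 0" using z(2) by (rule odd_pos)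
  have z0: "z \<noteq> 0" using z(1) N by (rule root_of_unity_nonzero)
  \<comment> \<open>Inverses are rewritten as nonnegative powers so that the relation becomes a
    polynomial in \<open>z\<close>.\<close>
  have inv: "inverse (z ^ k) = z ^ ((N - 1) * k)" for k
  proof -
    have "z ^ ((N - 1) * k) * z ^ k = (z ^ (N - 1 + 1)) ^ k"
      by (simp add: power_add power_mult power_mult_distrib flip: power_mult)
    also have "\<dots> = 1" using N z by simp
    finally show ?thesis using z0 by (simp add: field_simps)
  qed
  define E where "E f k = smult f (monom 1 k + monom 1 ((N - 1) * k))" for f :: int and k
  define F where "F = (1 + E e i) * (1 + E d j) - 1"
  have E1: "zeval z (E f k) = of_int f * z ^ k + inverse (of_int f * z ^ k)"
    if "f = 1 \<or> f = - 1" for f k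
    using that by (auto simp: E_def inv)
  have E2: "zeval (z ^ 2) (E f k) = of_int f * ((of_int f * z ^ k + inverse (of_int f * z ^ k)) ^ 2 - 2)"
    if "f = 1 \<or> f = - 1" for f k
  proof -
    have "zeval (z ^ 2) (E f k) = of_int f * ((z ^ k) ^ 2 + inverse (z ^ k) ^ 2)"
      by (simp add: E_def inv mult.commute flip: power_mult)
    also have "\<dots> = of_int f * ((z ^ k + inverse (z ^ k)) ^ 2 - 2)"
      using z0 by (simp add: power2_sum)
    finally show ?thesis using that by (auto simp: power2_eq_square algebra_simps)
  qed
  have "zeval z F = 0"
    using uv by (simp add: F_def E1 e u v tri_def add.assoc)
  then have "zeval (z ^ 2) F = 0" by (rule zeval_square_root_of_unity[OF z])
  then show ?thesis by (simp add: F_def E2 e u v)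
qed

text \<open>The cubic is Eisenstein at 2, so 2 would divide the cube of any root in Z[z]. But
  \<open>X\<close> is a unit, because \<open>u ^ 2\<close> has odd order and
  \<open>1 + u ^ 2\<close> is a unit.\<close>

lemma trace_ne_eisenstein_root:
  assumes "z ^ M = 1" "M > 0" "u ^ (2 * N) = 1" "odd N" "u \<in> zadj z" "u \<noteq> 1" "u \<noteq> - 1"
    and X: "X = u + inverse u"
  shows "X ^ 3 + 2 * X ^ 2 - 2 * X - 2 \<noteq> 0"
proof
  assume eq: "X ^ 3 + 2 * X ^ 2 - 2 * X - 2 = 0"
  have "N > 0" using assms(4) by (rule odd_pos)
  then have u0: "u \<noteq> 0" using assms(3) \<open>N > 0\<close> by (intro root_of_unity_nonzero[of u "2 * N"]) auto
  have "(u ^ 2) ^ N = 1" using assms(3) by (simp add: power_mult)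
  moreover have "u ^ 2 \<noteq> 1" using assms(6,7) by (simp add: power2_eq_1_iff)
  ultimately obtain y where y: "(1 + u ^ 2) * y = 1" "y \<in> zadj z"
    using one_plus_unit[of "u ^ 2" N] assms(4,5) by (metis zadj_power zadj_sum)
  define w where "w = u * y"
  have w: "w \<in> zadj z" using y assms(5) by (auto simp: w_def intro: zadj_mult)
  have "u * inverse u = 1" using u0 by simp
  then have "X * w = 1" unfolding X w_def using y(1) by algebra
  \<comment> \<open>This is the cubic multiplied by \<open>w ^ 3\<close>, where \<open>w\<close> is
    the inverse of \<open>X\<close>.\<close>
  then have "of_int 1 = 2 * (w ^ 3 + w ^ 2 - w)" unfolding of_int_1 using eq by algebra
  then show False using odd_ne_double_zadj[OF assms(1,2), of 1 "w ^ 3 + w ^ 2 - w"] w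
    by (auto intro!: zadj_intros)
qed

lemma tri_prod_1:
  assumes z: "z ^ N = 1" "odd N" and e: "(e :: int) = 1 \<or> e = - 1" "(d :: int) = 1 \<or> d = - 1"
    and u: "u = of_int e * z ^ i" "u \<noteq> 1" "u \<noteq> - 1"
    and v: "v = of_int d * z ^ j" "v \<noteq> 1" "v \<noteq> - 1"
    and uv: "tri u * tri v = 1"
  shows "u ^ 5 = - 1"
proof -
  define X where "X = u + inverse u"
  define Y where "Y = v + inverse v"
  have N: "N > 0" using z(2) by (rule odd_pos)
  have z0: "z \<noteq> 0" using z(1) N by (rule root_of_unity_nonzero)
  have zi: "z ^ (k * (2 * N)) = 1" for k
    using z(1) by (metis power_mult mult.commute power_one)
  have u2N: "u ^ (2 * N) = 1" using e u zi by (auto simp: power_mult_distrib simp flip: power_mult)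
  have v2N: "v ^ (2 * N) = 1" using e v zi by (auto simp: power_mult_distrib simp flip: power_mult)
  have uz: "u \<in> zadj z" "v \<in> zadj z" using u v by (auto intro!: zadj_intros)
  have u0: "u \<noteq> 0" using u z0 e by auto
  have Xu: "X * u = u ^ 2 + 1" using u0 by (simp add: X_def field_simps power2_eq_square)
  have X2: "X ^ 2 \<noteq> 4"
  proof
    assume X4: "X ^ 2 = 4"
    have "(u ^ 2 - 1) ^ 2 = (X * u) ^ 2 - 4 * u ^ 2" unfolding Xu by algebra
    also have "\<dots> = 0" unfolding power_mult_distrib X4 by simp
    finally have "(u ^ 2 - 1) ^ 2 = 0" .
    then show False using u by (simp add: power2_eq_1_iff)
  qed
  have X0: "X \<noteq> 0"
  proof
    assume "X = 0"
    then have "u ^ 2 = - 1" using Xu by (simp add: eq_neg_iff_add_eq_0)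
    then show False using u2N z(2) by (simp add: power_mult)
  qed
  have XY: "(1 + X) * (1 + Y) = 1" using uv by (simp add: X_def Y_def tri_def add.assoc)
  then have X1: "1 + X \<noteq> 0" "1 + Y \<noteq> 0" by auto
  have conj: "(1 + of_int e * (X ^ 2 - 2)) * (1 + of_int d * (Y ^ 2 - 2)) = 1"
    unfolding X_def Y_def by (rule tri_prod_1_conjugate[OF z e u(1) v(1) uv])
  have nex: "X ^ 3 + 2 * X ^ 2 - 2 * X - 2 \<noteq> 0"
    by (rule trace_ne_eisenstein_root[OF z(1) N u2N z(2) uz(1) u(2,3) X_def])
  have ney: "Y ^ 3 + 2 * Y ^ 2 - 2 * Y - 2 \<noteq> 0"
    by (rule trace_ne_eisenstein_root[OF z(1) N v2N z(2) uz(2) v(2,3) Y_def])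
  \<comment> \<open>Eliminating one variable gives a condition for each sign pattern: both signs 1
    force \<open>X = 0\<close>, opposite signs give the excluded cubic in \<open>X\<close> or
    \<open>Y\<close>, and both signs -1 leave \<open>X ^ 2 = X + 1\<close>, since
    \<open>X = - 2\<close> would mean \<open>u = - 1\<close>.\<close>
  consider "e = 1" "d = 1" | "e = 1" "d = - 1" | "e = - 1" "d = 1" | "e = - 1" "d = - 1"
    using e by blast
  then have "X ^ 2 - X - 1 = 0"
  proof cases
    case 1
    then have "(1 + X ^ 2 - 2) * (1 + Y ^ 2 - 2) = 1" using conj by (simp add: algebra_simps)
    then have "X ^ 2 * (1 + X) = 0" using XY by algebra
    then show ?thesis using X0 X1 by simp
  next
    case 2
    then have "(1 + (X ^ 2 - 2)) * (1 - (Y ^ 2 - 2)) = 1" using conj by simp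
    then have "(1 + X) * (X ^ 3 + 2 * X ^ 2 - 2 * X - 2) = 0" using XY by algebra
    then show ?thesis using nex X1 by simp
  next
    case 3
    then have "(1 - (X ^ 2 - 2)) * (1 + (Y ^ 2 - 2)) = 1" using conj by simp
    then have "(1 + Y) * (Y ^ 3 + 2 * Y ^ 2 - 2 * Y - 2) = 0" using XY by algebra
    then show ?thesis using ney X1 by simp
  next
    case 4
    then have "(1 - (X ^ 2 - 2)) * (1 - (Y ^ 2 - 2)) = 1" using conj by simp
    then have "(X + 2) ^ 2 * (X ^ 2 - X - 1) = 0" using XY by algebra
    moreover have "X + 2 \<noteq> 0"
    proof
      assume "X + 2 = 0"
      then have "X ^ 2 = 4" by algebra
      then show False using X2 by simp
    qed
    ultimately show ?thesis by simp
  qed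
  \<comment> \<open>Multiplied by \<open>u ^ 2\<close>, the equation becomes the cofactor of
    \<open>u + 1\<close> in \<open>u ^ 5 + 1\<close>.\<close>
  then have "(X * u) ^ 2 - (X * u) * u - u ^ 2 = 0" by algebra
  then have "(u + 1) * (u ^ 4 - u ^ 3 + u ^ 2 - u + 1) = 0" unfolding Xu by algebra
  then have "u ^ 5 + 1 = 0" by algebra
  then show ?thesis by (simp add: eq_neg_iff_add_eq_0)
qed

section \<open>Boards and the discrete sine transform\<close>

text \<open>The index \<open>i\<close> itself is included, so that a cell together with its
  neighbors forms a product of three such sets.\<close>

definition nbhd :: "nat \<Rightarrow> nat \<Rightarrow> nat set" where
  "nbhd n i = {j \<in> {1..n}. \<bar>int i - int j\<bar> \<le> 1}"

lemma finite_nbhd [simp]: "finite (nbhd n i)"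
  by (simp add: nbhd_def)

text \<open>The zeros at 0 and \<open>n + 1\<close> supply the terms cut off at the border.\<close>

lemma sum_nbhd:
  assumes "f 0 = 0" "f (n + 1) = 0" "i \<in> {1..n}"
  shows "sum f (nbhd n i) = f (i - 1) + f i + f (i + 1)"
proof -
  have "sum f (nbhd n i) = sum f {i - 1, i, i + 1}"
  proof (rule sum.mono_neutral_left)
    show "nbhd n i \<subseteq> {i - 1, i, i + 1}" by (auto simp: nbhd_def)
    show "\<forall>j\<in>{i - 1, i, i + 1} - nbhd n i. f j = 0"
    proof
      fix j assume j: "j \<in> {i - 1, i, i + 1} - nbhd n i"
      then have "j = 0 \<or> j = n + 1" using assms(3) by (auto simp: nbhd_def)
      then show "f j = 0" using assms by auto
    qed
  qed simp
  moreover obtain m where "i = Suc m" using assms(3) by (cases i) auto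
  ultimately show ?thesis by (simp add: add.assoc)
qed

lemma sum_neighbors_plus_self:
  assumes "i \<in> {1..n}" "j \<in> {1..n}" "k \<in> {1..n}"
  shows "B (i, j, k) + (\<Sum>d \<in> {d \<in> cells n. neighbors (i, j, k) d}. B d)
    = (\<Sum>a\<in>nbhd n i. \<Sum>b\<in>nbhd n j. \<Sum>c\<in>nbhd n k. B (a, b, c))"
proof -
  have "finite {d \<in> cells n. neighbors (i, j, k) d}" by (simp add: cells_def)
  then have "B (i, j, k) + (\<Sum>d \<in> {d \<in> cells n. neighbors (i, j, k) d}. B d)
    = sum B (insert (i, j, k) {d \<in> cells n. neighbors (i, j, k) d})" by simp
  also have "insert (i, j, k) {d \<in> cells n. neighbors (i, j, k) d} = nbhd n i \<times> nbhd n j \<times> nbhd n k"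
    using assms by (auto simp: cells_def nbhd_def)
  also have "sum B \<dots> = (\<Sum>a\<in>nbhd n i. \<Sum>b\<in>nbhd n j. \<Sum>c\<in>nbhd n k. B (a, b, c))"
    by (simp add: sum.cartesian_product case_prod_beta)
  finally show ?thesis .
qed

lemma neighbor_sum_property_iff:
  "neighbor_sum_property n B \<longleftrightarrow> (\<forall>i\<in>{1..n}. \<forall>j\<in>{1..n}. \<forall>k\<in>{1..n}.
     (\<Sum>a\<in>nbhd n i. \<Sum>b\<in>nbhd n j. \<Sum>c\<in>nbhd n k. B (a, b, c)) = 2 * B (i, j, k))"
proof -
  have "neighbor_sum_property n B \<longleftrightarrow> (\<forall>i\<in>{1..n}. \<forall>j\<in>{1..n}. \<forall>k\<in>{1..n}.
     B (i, j, k) = (\<Sum>d \<in> {d \<in> cells n. neighbors (i, j, k) d}. B d))"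
    by (auto simp: neighbor_sum_property_def cells_def)
  also have "\<dots> \<longleftrightarrow> (\<forall>i\<in>{1..n}. \<forall>j\<in>{1..n}. \<forall>k\<in>{1..n}.
     (\<Sum>a\<in>nbhd n i. \<Sum>b\<in>nbhd n j. \<Sum>c\<in>nbhd n k. B (a, b, c)) = 2 * B (i, j, k))"
    by (intro ball_cong refl, subst sum_neighbors_plus_self [symmetric]) auto
  finally show ?thesis .
qed

section \<open>Explicit boards from integer eigenvectors\<close>

text \<open>For \<open>x = 2 * cos t\<close> with \<open>sin t\<close> nonzero,
  \<open>cheb x i\<close> is \<open>sin (i * t) / sin t\<close>, a Chebyshev value of the second
  kind. The cases \<open>x = 1\<close> and \<open>x = 0\<close> belong to the angles pi/3 and pi/2,
  with eigenvalues 2 and 1.\<close>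

fun cheb :: "int \<Rightarrow> nat \<Rightarrow> int" where
  "cheb x 0 = 0"
| "cheb x (Suc 0) = 1"
| "cheb x (Suc (Suc i)) = x * cheb x (Suc i) - cheb x i"

lemma sum_nbhd_cheb:
  assumes "cheb x (n + 1) = 0" "i \<in> {1..n}"
  shows "sum (cheb x) (nbhd n i) = (1 + x) * cheb x i"
proof -
  obtain m where "i = Suc m" using assms(2) by (cases i) auto
  then show ?thesis using sum_nbhd[of "cheb x" n i] assms by (simp add: algebra_simps)
qed

lemma cheb_1_zero: "cheb 1 (3 * m) = 0"
  by (induction m) (auto simp: numeral_3_eq_3)

lemma cheb_0_zero: "cheb 0 (2 * m) = 0"
  by (induction m) auto

text \<open>With \<open>golden j = (a, b)\<close>, the number \<open>a + b \<phi>\<close> for \<open>\<phi> = (1 + sqrt 5) / 2\<close>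
  is \<open>sin (j pi / 5) / sin (pi / 5)\<close>, and \<open>a + b (1 - \<phi>)\<close> is its conjugate
  \<open>sin (3 j pi / 5) / sin (3 pi / 5)\<close>. The form \<open>golden_trace j k\<close> is the trace of
  \<open>(a + b \<phi>) (c + d (1 - \<phi>))\<close>, where \<open>golden k = (c, d)\<close>.\<close>

fun golden :: "nat \<Rightarrow> int \<times> int" where
  "golden 0 = (0, 0)"
| "golden (Suc 0) = (1, 0)"
| "golden (Suc (Suc i)) = (snd (golden (Suc i)) - fst (golden i),
     fst (golden (Suc i)) + snd (golden (Suc i)) - snd (golden i))"

definition golden_trace :: "nat \<Rightarrow> nat \<Rightarrow> int" where
  "golden_trace j k = 2 * fst (golden j) * fst (golden k) + fst (golden j) * snd (golden k)
     + snd (golden j) * fst (golden k) - 2 * snd (golden j) * snd (golden k)"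

lemma golden_zero: "golden (5 * m) = (0, 0)"
proof (induction m)
  case (Suc m)
  have "5 * Suc m = Suc (Suc (Suc (Suc (Suc (5 * m)))))" by simp
  then show ?case using Suc by (simp del: mult_Suc_right)
qed simp

text \<open>In coordinates this is multiplication by \<phi> + 1, using \<phi>^2 = \<phi> +
  1.\<close>

lemma sum_nbhd_golden:
  assumes "golden (n + 1) = (0, 0)" "i \<in> {1..n}"
  shows "(\<Sum>j\<in>nbhd n i. fst (golden j)) = fst (golden i) + snd (golden i)"
    and "(\<Sum>j\<in>nbhd n i. snd (golden j)) = fst (golden i) + 2 * snd (golden i)"
proof -
  obtain m where "i = Suc m" using assms(2) by (cases i) auto
  then show "(\<Sum>j\<in>nbhd n i. fst (golden j)) = fst (golden i) + snd (golden i)"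
    and "(\<Sum>j\<in>nbhd n i. snd (golden j)) = fst (golden i) + 2 * snd (golden i)"
    using sum_nbhd[of "\<lambda>j. fst (golden j)" n i] sum_nbhd[of "\<lambda>j. snd (golden j)" n i] assms
    by (simp_all add: algebra_simps)
qed

text \<open>The two directions multiply by 1 + \<phi> and by its conjugate 2 - \<phi>, whose product
  is 1. The trace keeps the entries integral.\<close>

lemma sum_nbhd_golden_trace:
  assumes "golden (n + 1) = (0, 0)" "j \<in> {1..n}" "k \<in> {1..n}"
  shows "(\<Sum>b\<in>nbhd n j. \<Sum>c\<in>nbhd n k. golden_trace b c) = golden_trace j k"
proof -
  define a where "a i = fst (golden i)" for i
  define d where "d i = snd (golden i)" for i
  have split: "(\<Sum>b\<in>S. \<Sum>c\<in>T. golden_trace b c)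
    = 2 * sum a S * sum a T + sum a S * sum d T + sum d S * sum a T - 2 * sum d S * sum d T" for S T
    unfolding golden_trace_def a_def[symmetric] d_def[symmetric]
    by (simp add: sum.distrib sum_subtractf flip: sum_distrib_left sum_distrib_right)
  show ?thesis
    unfolding split using sum_nbhd_golden[OF assms(1,2)] sum_nbhd_golden[OF assms(1,3)]
    by (simp add: a_def d_def golden_trace_def algebra_simps)
qed

text \<open>The eigenvalues 2 and 1 multiply to 2. The factor \<open>W\<close> is kept
  two-dimensional because \<open>golden_trace\<close> does not split into integer factors.\<close>

lemma board_of_eigenvectors:
  fixes s :: "nat \<Rightarrow> int" and W :: "nat \<Rightarrow> nat \<Rightarrow> int"
  assumes "\<And>i. i \<in> {1..n} \<Longrightarrow> sum s (nbhd n i) = 2 * s i"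
    and "\<And>j k. j \<in> {1..n} \<Longrightarrow> k \<in> {1..n} \<Longrightarrow> (\<Sum>b\<in>nbhd n j. \<Sum>c\<in>nbhd n k. W b c) = W j k"
    and "n \<ge> 1" "s 1 \<noteq> 0" "W 1 1 \<noteq> 0"
  shows "\<exists>B. nontrivial_board n B \<and> neighbor_sum_property n B"
proof -
  define B where "B = (\<lambda>(i, j, k). s i * W j k)"
  have "neighbor_sum_property n B"
    unfolding neighbor_sum_property_iff
    by (simp add: B_def assms(1,2) flip: sum_distrib_left sum_distrib_right)
  moreover have "nontrivial_board n B"
    unfolding nontrivial_board_def
    by (rule bexI[of _ "(1, 1, 1)"]) (use assms(3-5) in \<open>auto simp: B_def cells_def\<close>)
  ultimately show ?thesis by blast
qed

lemma board_exists:
  assumes "n \<ge> 3" "6 dvd (n + 1) \<or> 15 dvd (n + 1)"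
  shows "\<exists>B. nontrivial_board n B \<and> neighbor_sum_property n B"
proof -
  have "3 dvd n + 1" using assms(2) by presburger
  then have "cheb 1 (n + 1) = 0" by (metis dvdE cheb_1_zero)
  then have s: "sum (cheb 1) (nbhd n i) = 2 * cheb 1 i" if "i \<in> {1..n}" for i
    using sum_nbhd_cheb that by fastforce
  from assms(2) show ?thesis
  proof
    assume "6 dvd (n + 1)"
    then have "2 dvd n + 1" by presburger
    then have "cheb 0 (n + 1) = 0" by (metis dvdE cheb_0_zero)
    then have c: "sum (cheb 0) (nbhd n i) = cheb 0 i" if "i \<in> {1..n}" for i
      using sum_nbhd_cheb that by fastforce
    show ?thesis
      using s assms(1)
      by (intro board_of_eigenvectors[of n "cheb 1" "\<lambda>j k. cheb 0 j * cheb 0 k"])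
        (auto simp: c simp flip: sum_product)
  next
    assume "15 dvd (n + 1)"
    then have "5 dvd n + 1" by presburger
    then have "golden (n + 1) = (0, 0)" by (metis dvdE golden_zero)
    then show ?thesis
      using s assms(1)
      by (intro board_of_eigenvectors[of n "cheb 1" golden_trace])
        (auto simp: sum_nbhd_golden_trace, auto simp: golden_trace_def)
  qed
qed

section \<open>The discrete sine transform\<close>

definition sn :: "nat \<Rightarrow> nat \<Rightarrow> nat \<Rightarrow> real" where
  "sn n p i = sin (real p * real i * pi / real (n + 1))"

definition eig :: "nat \<Rightarrow> nat \<Rightarrow> real" where
  "eig n p = 1 + 2 * cos (real p * pi / real (n + 1))"

lemma sum_nbhd_sn:
  assumes "i \<in> {1..n}"
  shows "sum (sn n p) (nbhd n i) = eig n p * sn n p i"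
proof -
  define t where "t = real p * pi / real (n + 1)"
  have sn: "sn n p j = sin (real j * t)" for j by (simp add: sn_def t_def field_simps)
  have "sn n p (n + 1) = sin (real p * pi)" by (simp add: sn_def)
  then have "sn n p (n + 1) = 0" by simp
  then have "sum (sn n p) (nbhd n i) = sn n p (i - 1) + sn n p i + sn n p (i + 1)"
    using assms by (intro sum_nbhd) (auto simp: sn_def)
  moreover have shift: "real (i - 1) * t = real i * t - t" "real (i + 1) * t = real i * t + t"
    using assms by (auto simp: algebra_simps of_nat_diff)
  have "sn n p (i - 1) + sn n p i + sn n p (i + 1) = (1 + 2 * cos t) * sn n p i"
    unfolding sn shift sin_add sin_diff by (simp add: algebra_simps)
  ultimately show ?thesis by (simp add: eig_def t_def)
qed

text \<open>Multiplication by \<open>2 * sin (t / 2)\<close> makes the sum telescope; the bounds on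
  \<open>k\<close> keep that sine positive.\<close>

lemma sum_cos_multiples:
  assumes "0 < k" "k < 2 * N"
  shows "(\<Sum>p<N. cos (real p * (real k * pi / real N))) = (1 - cos (real k * pi)) / 2"
proof -
  define t where "t = real k * pi / real N"
  have N: "N > 0" using assms by auto
  have "0 < t / 2" "t / 2 < pi" using assms N by (auto simp: t_def field_simps)
  then have s: "sin (t / 2) > 0" by (rule sin_gt_zero)
  have "2 * sin (t / 2) * (\<Sum>p<m. cos (real p * t)) = sin (real m * t - t / 2) + sin (t / 2)" for m
  proof (induction m)
    case (Suc m)
    have "real (Suc m) * t - t / 2 = real m * t + t / 2" by (simp add: algebra_simps)
    then show ?case using Suc by (simp add: algebra_simps sin_add sin_diff)
  qed simp
  from this[of N] have "2 * sin (t / 2) * (\<Sum>p<N. cos (real p * t)) = sin (t / 2) * (1 - cos (real k * pi))"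
    using N by (simp add: t_def sin_diff algebra_simps)
  then have "sin (t / 2) * (2 * (\<Sum>p<N. cos (real p * t))) = sin (t / 2) * (1 - cos (real k * pi))"
    by (simp only: mult_ac)
  then have "2 * (\<Sum>p<N. cos (real p * t)) = 1 - cos (real k * pi)"
    using s by (metis mult_cancel_left less_irrefl)
  then show ?thesis by (simp add: t_def)
qed

text \<open>Products of sines become differences of cosine sums at \<open>i - j\<close> and
  \<open>i + j\<close>. These have the same parity, so the sums cancel unless \<open>i = j\<close>,
  where the first one is \<open>n + 1\<close>.\<close>

lemma sn_orthogonal:
  assumes "i \<in> {1..n}" "j \<in> {1..n}"
  shows "(\<Sum>p\<in>{1..n}. sn n p i * sn n p j) = (if i = j then real (n + 1) / 2 else 0)"
proof -
  define c where "c k = (\<Sum>p<n + 1. cos (real p * (real k * pi / real (n + 1))))" for k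
  have main: "(\<Sum>p\<in>{1..n}. sn n p i * sn n p j) = (c (i - j) - c (i + j)) / 2"
    if "j \<le> i" for i j
  proof -
    have prod_to_sum: "sn n p i * sn n p j = (cos (real p * (real (i - j) * pi / real (n + 1)))
        - cos (real p * (real (i + j) * pi / real (n + 1)))) / 2" for p
    proof -
      have "real p * (real (i - j) * pi / real (n + 1)) =
          real p * real i * pi / real (n + 1) - real p * real j * pi / real (n + 1)"
        "real p * (real (i + j) * pi / real (n + 1)) =
          real p * real i * pi / real (n + 1) + real p * real j * pi / real (n + 1)"
        by (simp_all only: of_nat_diff[OF that] of_nat_add left_diff_distrib right_diff_distrib distrib_left
            distrib_right diff_divide_distrib add_divide_distrib mult.assoc times_divide_eq_right)
      then show ?thesis unfolding sn_def by (simp add: cos_diff cos_add)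
    qed
    \<comment> \<open>The added term at \<open>p = 0\<close> is zero.\<close>
    have "(\<Sum>p\<in>{1..n}. sn n p i * sn n p j) = (\<Sum>p<n + 1. sn n p i * sn n p j)"
      by (rule sum.mono_neutral_left) (auto simp: sn_def Suc_le_eq)
    then show ?thesis
      unfolding c_def prod_to_sum by (simp add: sum_subtractf flip: sum_divide_distrib)
  qed
  have c: "c k = (1 - cos (real k * pi)) / 2" if "0 < k" "k < 2 * (n + 1)" for k
    unfolding c_def using that by (intro sum_cos_multiples)
  have c0: "c 0 = real (n + 1)" by (simp add: c_def)
  have off_diagonal: "(\<Sum>p\<in>{1..n}. sn n p i * sn n p j) = 0"
    if "j < i" "i \<in> {1..n}" "j \<in> {1..n}" for i j
  proof -
    have "real (i + j) * pi = real (i - j) * pi + 2 * real j * pi"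
      using that by (simp add: of_nat_diff algebra_simps)
    then have "cos (real (i + j) * pi) = cos (real (i - j) * pi)"
      by (simp only: cos_add cos_2npi sin_2npi mult_1_right mult_zero_right diff_zero)
    moreover have "c (i - j) = (1 - cos (real (i - j) * pi)) / 2"
      "c (i + j) = (1 - cos (real (i + j) * pi)) / 2"
      by (rule c; use that in simp)+
    ultimately show ?thesis using that main[of j i] by simp
  qed
  show ?thesis
  proof (cases i j rule: linorder_cases)
    case less
    then show ?thesis using off_diagonal[of i j] assms by (simp add: mult.commute)
  next
    case equal
    have "cos (real (j + j) * pi) = 1" using cos_2npi[of j] by (simp add: algebra_simps)
    then have "c (j + j) = 0" using assms by (subst c) auto
    then show ?thesis using equal main[of i i] c0 by simp
  next
    case greater
    then show ?thesis using off_diagonal[of j i] assms by simp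
  qed
qed

definition dst :: "nat \<Rightarrow> nat \<Rightarrow> (nat \<Rightarrow> real) \<Rightarrow> real" where
  "dst n p f = (\<Sum>i\<in>{1..n}. f i * sn n p i)"

lemma dst_sum: "dst n p (\<lambda>i. \<Sum>a\<in>S. f a i) = (\<Sum>a\<in>S. dst n p (f a))"
  unfolding dst_def sum_distrib_right by (rule sum.swap)

lemma dst_mult: "dst n p (\<lambda>i. c * f i) = c * dst n p f"
  by (simp add: dst_def sum_distrib_left mult.assoc)

lemma dst_cong: "(\<And>i. i \<in> {1..n} \<Longrightarrow> f i = g i) \<Longrightarrow> dst n p f = dst n p g"
  unfolding dst_def by (intro sum.cong) auto

text \<open>Adjacency is symmetric, so the neighborhood sum moves onto the eigenvector
  \<open>sn n p\<close>.\<close>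

lemma dst_sum_nbhd: "dst n p (\<lambda>i. sum f (nbhd n i)) = eig n p * dst n p f"
proof -
  have "dst n p (\<lambda>i. sum f (nbhd n i))
      = (\<Sum>i\<in>{1..n}. \<Sum>j\<in>{j \<in> {1..n}. \<bar>int i - int j\<bar> \<le> 1}. f j * sn n p i)"
    by (simp add: dst_def nbhd_def sum_distrib_right)
  also have "\<dots> = (\<Sum>j\<in>{1..n}. \<Sum>i\<in>{i \<in> {1..n}. \<bar>int i - int j\<bar> \<le> 1}. f j * sn n p i)"
    by (rule sum.swap_restrict) auto
  also have "\<dots> = (\<Sum>j\<in>{1..n}. f j * sum (sn n p) (nbhd n j))"
    by (simp add: nbhd_def abs_minus_commute sum_distrib_left)
  also have "\<dots> = eig n p * dst n p f"
    by (simp add: sum_nbhd_sn dst_def sum_distrib_left mult_ac)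
  finally show ?thesis .
qed

lemma dst_inject:
  assumes "\<And>p. p \<in> {1..n} \<Longrightarrow> dst n p f = 0" "j \<in> {1..n}"
  shows "f j = 0"
proof -
  have "0 = (\<Sum>p\<in>{1..n}. \<Sum>i\<in>{1..n}. f i * sn n p i * sn n p j)"
    using assms(1) by (simp add: dst_def flip: sum_distrib_right)
  also have "\<dots> = (\<Sum>i\<in>{1..n}. f i * (\<Sum>p\<in>{1..n}. sn n p i * sn n p j))"
    by (subst sum.swap) (simp add: sum_distrib_left mult.assoc)
  also have "\<dots> = (\<Sum>i\<in>{1..n}. if i = j then f j * (real (n + 1) / 2) else 0)"
    using assms(2) by (intro sum.cong refl) (subst sn_orthogonal, auto)
  also have "\<dots> = f j * (real (n + 1) / 2)" using assms(2) by simp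
  finally show ?thesis by simp
qed

text \<open>The triple transform multiplies each coefficient by an eigenvalue product, while the
  board equation multiplies it by 2. If no product is 2, all coefficients vanish, and
  \<open>dst_inject\<close> in each coordinate makes the board zero.\<close>

lemma eigenvalue_of_board:
  assumes "nontrivial_board n B" "neighbor_sum_property n B"
  shows "\<exists>p\<in>{1..n}. \<exists>q\<in>{1..n}. \<exists>r\<in>{1..n}. eig n p * eig n q * eig n r = 2"
proof (rule ccontr)
  assume neg: "\<not> ?thesis"
  define R where "R i j k = real_of_int (B (i, j, k))" for i j k
  have R: "2 * R i j k = (\<Sum>a\<in>nbhd n i. \<Sum>b\<in>nbhd n j. \<Sum>c\<in>nbhd n k. R a b c)"
    if "i \<in> {1..n}" "j \<in> {1..n}" "k \<in> {1..n}" for i j k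
  proof -
    have "2 * B (i, j, k) = (\<Sum>a\<in>nbhd n i. \<Sum>b\<in>nbhd n j. \<Sum>c\<in>nbhd n k. B (a, b, c))"
      using assms(2) that unfolding neighbor_sum_property_iff by simp
    from arg_cong[OF this, of real_of_int] show ?thesis by (simp add: R_def)
  qed
  have zero: "dst n p (\<lambda>i. dst n q (\<lambda>j. dst n r (R i j))) = 0"
    if pqr: "p \<in> {1..n}" "q \<in> {1..n}" "r \<in> {1..n}" for p q r
  proof -
    have "2 * dst n p (\<lambda>i. dst n q (\<lambda>j. dst n r (R i j)))
        = dst n p (\<lambda>i. dst n q (\<lambda>j. dst n r (\<lambda>k. 2 * R i j k)))"
      by (simp add: dst_mult)
    also have "\<dots> = dst n p (\<lambda>i. dst n q (\<lambda>j. dst n r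
        (\<lambda>k. \<Sum>a\<in>nbhd n i. \<Sum>b\<in>nbhd n j. \<Sum>c\<in>nbhd n k. R a b c)))"
      by (intro dst_cong R)
    also have "\<dots> = eig n p * eig n q * eig n r * dst n p (\<lambda>i. dst n q (\<lambda>j. dst n r (R i j)))"
      by (simp add: dst_sum dst_sum_nbhd dst_mult mult_ac)
    finally show ?thesis using neg pqr by auto
  qed
  have "R i j k = 0" if "i \<in> {1..n}" "j \<in> {1..n}" "k \<in> {1..n}" for i j k
    using that by (intro dst_inject[of n "R i j" k] dst_inject[of n "\<lambda>j. dst n _ (R i j)" j]
      dst_inject[of n "\<lambda>i. dst n _ (\<lambda>j. dst n _ (R i j))" i] zero)
  then show False using assms(1) by (auto simp: nontrivial_board_def cells_def R_def)
qed

section \<open>Triples of angles with product 2\<close>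

lemma tri_cis: "tri (cis t) = of_real (1 + 2 * cos t)"
  by (simp add: tri_def complex_eq_iff)

lemma cis_ne_pm1:
  assumes "0 < t" "t < pi"
  shows "cis t \<noteq> 1" "cis t \<noteq> - 1"
  using sin_gt_zero[OF assms] by (auto simp: complex_eq_iff)

lemma angle_in_open_range:
  assumes "p \<in> {1..n}"
  shows "0 < real p * pi / real (n + 1)" "real p * pi / real (n + 1) < pi"
proof -
  show "0 < real p * pi / real (n + 1)" using assms by simp
  have "real p * pi < real (n + 1) * pi" using assms by (intro mult_strict_right_mono) auto
  then show "real p * pi / real (n + 1) < pi" by (simp add: pos_divide_less_eq mult.commute)
qed

text \<open>For odd \<open>p\<close> the number \<open>p + N\<close> is even, and the added half
  turn accounts for the sign.\<close>

lemma cis_eq_signed_power: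
  assumes "odd N" "z = cis (2 * pi / real N)"
  shows "\<exists>(e :: int) i. (e = 1 \<or> e = - 1) \<and> cis (real p * pi / real N) = of_int e * z ^ i"
proof -
  have N: "real N > 0" using odd_pos[OF assms(1)] by simp
  show ?thesis
  proof (cases "even p")
    case True
    then obtain i where "p = 2 * i" by (elim evenE)
    then have "cis (real p * pi / real N) = of_int 1 * z ^ i"
      by (simp add: assms(2) Complex.DeMoivre mult_ac)
    then show ?thesis by blast
  next
    case False
    then have "even (p + N)" using assms(1) by simp
    then obtain i where i: "p + N = 2 * i" by (elim evenE)
    have "real p * pi / real N + pi = real (p + N) * pi / real N"
      using N by (simp add: field_simps)
    also have "\<dots> = real i * (2 * pi / real N)" unfolding i by simp
    finally have "- cis (real p * pi / real N) = z ^ i"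
      by (simp add: assms(2) Complex.DeMoivre flip: cis_mult cis_pi) (metis cis_mult cis_pi mult_minus1_right)
    then have "cis (real p * pi / real N) = of_int (- 1) * z ^ i" by (simp add: minus_equation_iff)
    then show ?thesis by blast
  qed
qed

text \<open>The imaginary part shows that \<open>n + 1\<close> divides \<open>5 * p\<close>; if it
  were coprime to 5 it would divide \<open>p\<close>, which is at most \<open>n\<close>.\<close>

lemma five_dvd_of_cis_power_5:
  assumes "p \<in> {1..n}" "cis (real p * pi / real (n + 1)) ^ 5 = - 1"
  shows "5 dvd n + 1"
proof -
  have "cis (5 * (real p * pi / real (n + 1))) = - 1"
    using assms(2) by (simp add: Complex.DeMoivre)
  then have "sin (5 * (real p * pi / real (n + 1))) = 0" by (simp add: complex_eq_iff)
  then obtain k :: int where "5 * (real p * pi / real (n + 1)) = of_int k * pi"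
    by (auto simp: sin_zero_iff_int2)
  then have "(5 * real p) * pi = (of_int k * real (n + 1)) * pi"
    by (simp add: divide_simps mult_ac del: of_nat_Suc of_nat_add)
  then have "5 * real p = of_int k * real (n + 1)" unfolding mult_cancel_right using pi_neq_zero by blast
  then have "real_of_int (5 * int p) = real_of_int (k * int (n + 1))" by simp
  then have "5 * int p = k * int (n + 1)" by (simp only: of_int_eq_iff)
  then have dvd: "n + 1 dvd 5 * p" by (metis dvd_triv_right int_dvd_int_iff of_nat_mult of_nat_numeral)
  show ?thesis
  proof (rule ccontr)
    assume "\<not> 5 dvd n + 1"
    then have "coprime (5 :: nat) (n + 1)" by (intro prime_imp_coprime) auto
    then have "n + 1 dvd p" using dvd by (metis coprime_commute coprime_dvd_mult_right_iff)
    then show False using assms(1) by (auto dest: dvd_imp_le)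
  qed
qed

lemma five_dvd_of_eig_prod_1:
  assumes "even n" "p \<in> {1..n}" "q \<in> {1..n}" "eig n p * eig n q = 1"
  shows "5 dvd n + 1"
proof -
  define z where "z = cis (2 * pi / real (n + 1))"
  have odd: "odd (n + 1)" using assms(1) by simp
  have z: "z ^ (n + 1) = 1"
    unfolding z_def Complex.DeMoivre by (simp del: of_nat_Suc of_nat_add)
  define u where "u = cis (real p * pi / real (n + 1))"
  define v where "v = cis (real q * pi / real (n + 1))"
  obtain e i where e: "(e :: int) = 1 \<or> e = - 1" "u = of_int e * z ^ i"
    using cis_eq_signed_power[OF odd z_def] u_def by blast
  obtain d j where d: "(d :: int) = 1 \<or> d = - 1" "v = of_int d * z ^ j"
    using cis_eq_signed_power[OF odd z_def] v_def by blast
  have ne: "u \<noteq> 1" "u \<noteq> - 1" "v \<noteq> 1" "v \<noteq> - 1"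
    using cis_ne_pm1 angle_in_open_range assms(2,3) unfolding u_def v_def by blast+
  have "tri u * tri v = of_real (eig n p * eig n q)"
    unfolding u_def v_def tri_cis eig_def by simp
  then have "tri u * tri v = 1" using assms(4) by simp
  from tri_prod_1[OF z odd e(1) d(1) e(2) ne(1,2) d(2) ne(3,4) this]
  show ?thesis using five_dvd_of_cis_power_5[OF assms(2)] by (simp add: u_def)
qed

lemma dvd_of_eig_prod_2:
  assumes pqr: "p \<in> {1..n}" "q \<in> {1..n}" "r \<in> {1..n}" and prod: "eig n p * eig n q * eig n r = 2"
  shows "6 dvd n + 1 \<or> 15 dvd n + 1"
proof -
  define N where "N = n + 1"
  \<comment> \<open>All the numbers \<open>u x\<close> are powers of this root of unity of order
    \<open>2 * N\<close>, so one ring Z[z] contains them.\<close>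
  define z where "z = cis (pi / real N)"
  define u where "u x = cis (real x * pi / real N)" for x
  have N: "N > 0" by (simp add: N_def)
  have z: "z ^ (2 * N) = 1" using N by (simp add: z_def Complex.DeMoivre)
  have uz: "u x = z ^ x" for x by (simp add: u_def z_def Complex.DeMoivre)
  have u: "u x ^ (2 * N) = 1" "u x \<in> zadj z" for x
    using z by (auto simp: uz zadj_power mult.commute power_mult simp flip: power_mult)
      (metis mult.commute power_mult power_one)
  have une: "u x \<noteq> 1" "u x \<noteq> - 1" if "x \<in> {1..n}" for x
    using cis_ne_pm1 angle_in_open_range that unfolding u_def N_def by blast+
  have tri: "tri (u x) = of_real (eig n x)" for x
    unfolding u_def N_def tri_cis eig_def by simp
  have "tri (u p) * tri (u q) * tri (u r) = of_real (eig n p * eig n q * eig n r)"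
    by (simp add: tri)
  then have tprod: "tri (u p) * tri (u q) * tri (u r) = 2" using prod by simp
  have "3 dvd N"
  proof (rule ccontr)
    assume "\<not> 3 dvd N"
    then have "\<not> 3 dvd 2 * N" by presburger
    then have "tri (u p) * tri (u q) * tri (u r) \<noteq> 2"
      using N u une pqr by (intro tri_prod_ne_2_of_not_3_dvd[OF z]) auto
    then show False using tprod by simp
  qed
  show ?thesis
  proof (cases "even N")
    case True
    then show ?thesis using \<open>3 dvd N\<close> unfolding N_def by presburger
  next
    case False
    have "tri (u p) = 2 \<or> tri (u q) = 2 \<or> tri (u r) = 2"
      using N u une pqr by (intro tri_prod_2_odd[OF z _ False _ tprod]) auto
    then have "eig n p = 2 \<or> eig n q = 2 \<or> eig n r = 2"
      by (simp add: tri complex_eq_iff)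
    then have "eig n q * eig n r = 1 \<or> eig n p * eig n r = 1 \<or> eig n p * eig n q = 1"
      using prod by auto
    then have "5 dvd N"
      using five_dvd_of_eig_prod_1[of n] False pqr unfolding N_def by auto
    then show ?thesis using \<open>3 dvd N\<close> unfolding N_def by presburger
  qed
qed

section \<open>Existence of triples\<close>

text \<open>The double-angle and triple-angle formulas give two expressions for cos(3 pi/5), hence a
  quadratic equation for cos(pi/5).\<close>

lemma cos_pi_5_product: "(1 + 2 * cos (pi / 5)) * (1 + 2 * cos (3 * pi / 5)) = 1"
proof -
  define c where "c = cos (pi / 5)"
  have "c > 0" unfolding c_def by (rule cos_gt_zero) (auto simp: field_simps)
  have double: "cos (2 * (pi / 5)) = 2 * c ^ 2 - 1" unfolding c_def by (rule cos_double_cos)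
  have "3 * (pi / 5) = pi - 2 * (pi / 5)" by simp
  then have three: "cos (3 * (pi / 5)) = 1 - 2 * c ^ 2"
    by (simp only: cos_pi_minus double minus_diff_eq)
  have "cos (3 * (pi / 5)) = 4 * c ^ 3 - 3 * c" unfolding c_def by (rule cos_treble_cos)
  then have "(c + 1) * (4 * c ^ 2 - 2 * c - 1) = 0" using three by algebra
  then have "4 * c ^ 2 - 2 * c - 1 = 0" using \<open>c > 0\<close> by simp
  then have "(1 + 2 * c) * (1 + 2 * (1 - 2 * c ^ 2)) = 1" by algebra
  then show ?thesis using three by (simp add: c_def)
qed

text \<open>The angles are pi/3, pi/2, pi/2 with factors 2, 1, 1, or pi/3, pi/5, 3 pi/5, where the
  last two factors multiply to 1.\<close>

lemma eig_exists:
  assumes "6 dvd n + 1 \<or> 15 dvd n + 1"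
  shows "\<exists>p\<in>{1..n}. \<exists>q\<in>{1..n}. \<exists>r\<in>{1..n}. eig n p * eig n q * eig n r = 2"
  using assms
proof
  assume "6 dvd n + 1"
  then obtain m where m: "n + 1 = 6 * m" by (elim dvdE)
  then have "m > 0" by (cases m) auto
  then have "eig n (2 * m) = 2" "eig n (3 * m) = 1"
    unfolding eig_def m by (simp_all add: cos_60 field_simps)
  then show ?thesis using m \<open>m > 0\<close>
    by (intro bexI[of _ "2 * m"] bexI[of _ "3 * m"]) auto
next
  assume "15 dvd n + 1"
  then obtain m where m: "n + 1 = 15 * m" by (elim dvdE)
  then have "m > 0" by (cases m) auto
  then have "real (5 * m) * pi / real (15 * m) = pi / 3"
    "real (3 * m) * pi / real (15 * m) = pi / 5" "real (9 * m) * pi / real (15 * m) = 3 * pi / 5"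
    by (simp_all add: field_simps)
  then have "eig n (5 * m) = 1 + 2 * cos (pi / 3)" "eig n (3 * m) = 1 + 2 * cos (pi / 5)"
    "eig n (9 * m) = 1 + 2 * cos (3 * pi / 5)"
    by (simp_all only: eig_def m)
  then have "eig n (5 * m) * eig n (3 * m) * eig n (9 * m) = 2"
    using cos_pi_5_product by (simp only: mult.assoc) (simp add: cos_60)
  then show ?thesis using m \<open>m > 0\<close>
    by (intro bexI[of _ "5 * m"] bexI[of _ "3 * m"] bexI[of _ "9 * m"]) auto
qed

lemma eig_product_iff:
  "(\<exists>p :: nat \<Rightarrow> nat. (\<forall>i \<in> {1..3}. 1 \<le> p i \<and> p i \<le> n) \<and>
      (\<Prod>i = 1..3. 1 + 2 * cos (real (p i) * pi / real (n + 1))) = 2)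
    \<longleftrightarrow> (\<exists>p\<in>{1..n}. \<exists>q\<in>{1..n}. \<exists>r\<in>{1..n}. eig n p * eig n q * eig n r = 2)"
    (is "(\<exists>p. ?P p) \<longleftrightarrow> ?R")
proof
  have three: "{1..3} = {1, 2, 3 :: nat}" by auto
  show ?R if ex: "\<exists>p. ?P p"
  proof -
    obtain p where "?P p" using ex by blast
    then show ?R unfolding three eig_def[symmetric]
      by (intro bexI[of _ "p 1"] bexI[of _ "p 2"] bexI[of _ "p 3"]) (auto simp: mult.assoc)
  qed
  show "\<exists>p. ?P p" if ex: ?R
  proof -
    obtain p q r where pqr: "p \<in> {1..n}" "q \<in> {1..n}" "r \<in> {1..n}" "eig n p * eig n q * eig n r = 2"
      using ex by blast
    then show ?thesis
      unfolding three eig_def[symmetric]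
      by (intro exI[of _ "\<lambda>i. if i = 1 then p else if i = 2 then q else r"]) (auto simp: mult.assoc)
  qed
qed

theorem theorem29:
  fixes n :: nat
  assumes "n \<ge> 3"
  shows "((\<exists>p :: nat \<Rightarrow> nat. (\<forall>i \<in> {1..3}. 1 \<le> p i \<and> p i \<le> n) \<and>
            (\<Prod>i = 1..3. 1 + 2 * cos (real (p i) * pi / real (n + 1))) = 2)
          \<longleftrightarrow> 6 dvd (n + 1) \<or> 15 dvd (n + 1))
       \<and> ((\<exists>B :: cell \<Rightarrow> int. nontrivial_board n B \<and> neighbor_sum_property n B)
          \<longleftrightarrow> 6 dvd (n + 1) \<or> 15 dvd (n + 1))"
  unfolding eig_product_iff
  using dvd_of_eig_prod_2[of _ n] eig_exists[of n] eigenvalue_of_board[of n] board_exists[OF assms]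
  by blast

end
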